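(* Let $n\ge 1$. The statistics $\mathrm{ldes}$ and $\mathrm{lind}-1$ are equidistributed over $T_n$, i.e. $$\sum_{\pi\in T_n} q^{\mathrm{ldes}(\pi)} = \sum_{\pi\in T_n} q^{\mathrm{lind}(\pi)-1}.$$ Moreover, for any $B\subseteq[n-2]$ they are equidistributed over the set $$T_n(B):=\{\pi\in T_n \mid \mathrm{Des}(\pi^{-1})\cap [n-2] = B\},$$ namely $$\sum_{\pi\in T_n(B)} q^{\mathrm{ldes}(\pi)} = \sum_{\pi\in T_n(B)} q^{\mathrm{lind}(\pi)-1}.$$
   Context: $S_n$ is the symmetric group on $\{1,\dots,n\}$, and $[m]=\{1,\dots,m\}$ (empty if $m\le 0$). $T_n$ is the set of $321$-avoiding permutations: all $\pi\in S_n$ for which there are no $i<j<k$ with $\pi(i)>\pi(j)>\pi(k)$. For $\pi\in T_n$: $\mathrm{ldes}(\pi)=\max\{1\le i\le n-1 \mid \pi(i)>\pi(i+1)\}$ is the last descent, with $\mathrm{ldes}(\mathrm{id}):=0$; $\mathrm{lind}(\pi)=\pi^{-1}(n)$ is the index (position) of the digit $n$ in $\pi$; $\mathrm{Des}(\pi^{-1})=\{1\le i\le n-1\mid \pi^{-1}(i)>\pi^{-1}(i+1)\}$. Here $q$ is an indeterminate. *)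

theory Defs
  imports "HOL-Combinatorics.Permutations" "HOL-Computational_Algebra.Polynomial"
begin

text \<open>
  Elements of $S_n$ are functions on \<^typ>\<open>nat\<close> that permute \<^term>\<open>{1..n}\<close> and fix everything
  outside it; in particular the identity of $S_n$ is \<^const>\<open>id\<close> for every $n$.
\<close>

definition avoids_321 :: "nat \<Rightarrow> (nat \<Rightarrow> nat) \<Rightarrow> bool" where
  "avoids_321 n \<pi> \<longleftrightarrow>
     \<not> (\<exists>i\<in>{1..n}. \<exists>j\<in>{1..n}. \<exists>k\<in>{1..n}. i < j \<and> j < k \<and> \<pi> i > \<pi> j \<and> \<pi> j > \<pi> k)"

definition T_set :: "nat \<Rightarrow> (nat \<Rightarrow> nat) set" where
  "T_set n = {\<pi>. \<pi> permutes {1..n} \<and> avoids_321 n \<pi>}"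

definition Des :: "nat \<Rightarrow> (nat \<Rightarrow> nat) \<Rightarrow> nat set" where
  "Des n \<pi> = {i. 1 \<le> i \<and> i \<le> n - 1 \<and> \<pi> i > \<pi> (i + 1)}"

text \<open>A permutation other than the identity has a descent, so the maximum below is over a nonempty set.\<close>

definition ldes :: "nat \<Rightarrow> (nat \<Rightarrow> nat) \<Rightarrow> nat" where
  "ldes n \<pi> = (if \<pi> = id then 0 else Max (Des n \<pi>))"

definition lind :: "nat \<Rightarrow> (nat \<Rightarrow> nat) \<Rightarrow> nat" where
  "lind n \<pi> = inv \<pi> n"

text \<open>For \<^term>\<open>n \<le> (2::nat)\<close> truncated subtraction makes \<^term>\<open>{1..n - 2}\<close> empty, as required of $[n-2]$.\<close>

definition T_set_Des :: "nat \<Rightarrow> nat set \<Rightarrow> (nat \<Rightarrow> nat) set" where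
  "T_set_Des n B = {\<pi> \<in> T_set n. Des n (inv \<pi>) \<inter> {1..n - 2} = B}"

end

theory Submission
  imports Defs
begin

text \<open>
  Delete the largest entry \<open>n\<close> from a 321-avoiding permutation \<open>\<pi>\<close> of \<open>{1..n}\<close> and call the result
  \<open>\<sigma>\<close>; it is a 321-avoiding permutation of \<open>{1..n - 1}\<close>. Conversely, putting \<open>n\<close> back at position
  \<open>p\<close> creates a 321 pattern exactly when the entries to the right of \<open>n\<close> are not increasing, so
  with \<open>l\<close> the last descent of \<open>\<sigma>\<close> the admissible positions are \<open>p = l + 1, \<dots>, n\<close>
  (\<open>bij_betw_insert_max\<close>).

  On the fibre over a fixed \<open>\<sigma>\<close> the statistic \<open>lind - 1\<close> equals \<open>p - 1\<close> and so takes each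
  value in \<open>{l, \<dots>, n - 1}\<close> once. If \<open>p < n\<close>, the entry \<open>n\<close> is itself the last descent, and
  \<open>ldes = p\<close>; if \<open>p = n\<close>, nothing changes, and \<open>ldes = l\<close>. Hence \<open>ldes\<close> also takes each
  value in \<open>{l, \<dots>, n - 1}\<close> once, and the two statistics are equidistributed on every fibre
  (\<open>fibre_equidistribution\<close>).

  The relative order of the positions of \<open>1, \<dots>, n - 1\<close> is the same in \<open>\<pi>\<close> and \<open>\<sigma>\<close>, so
  the descents of the inverse below \<open>n - 1\<close> depend on \<open>\<sigma>\<close> only (\<open>Des_inv_insert_max\<close>). Both
  \<open>T_set n\<close> and \<open>T_set_Des n B\<close> are therefore unions of fibres.
\<close>

section \<open>The last descent\<close>

lemma Des_empty_imp_id: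
  assumes "\<pi> permutes {1..n}" "Des n \<pi> = {}"
  shows "\<pi> = id"
proof (rule permutes_natset_ge[OF assms(1)], rule ballI)
  fix i assume "i \<in> {1..n}"
  hence "1 \<le> i" "i \<le> n" by auto
  thus "i \<le> \<pi> i"
  proof (induction i rule: dec_induct)
    case base
    thus ?case using permutes_in_image[OF assms(1), of 1] by auto
  next
    case (step i)
    have "\<pi> i \<noteq> \<pi> (i + 1)"
      using permutes_inj[OF assms(1)] by (metis add_cancel_right_right injD zero_neq_one)
    moreover have "i \<notin> Des n \<pi>" using assms(2) by auto
    ultimately have "\<pi> i < \<pi> (i + 1)" using step by (auto simp: Des_def)
    thus ?case using step by auto
  qed
qed

text \<open>Only comparisons of \<^const>\<open>ldes\<close> with a bound occur below; this form covers the identity,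
  where \<^const>\<open>ldes\<close> is zero by convention, together with all other permutations.\<close>

lemma ldes_less_iff:
  assumes "\<pi> permutes {1..n}" "1 \<le> p"
  shows "ldes n \<pi> < p \<longleftrightarrow> (\<forall>i. p \<le> i \<and> i < n \<longrightarrow> \<pi> i < \<pi> (i + 1))"
proof (cases "\<pi> = id")
  case True
  thus ?thesis using assms by (auto simp: ldes_def)
next
  case False
  have fin: "finite (Des n \<pi>)" by (rule finite_subset[of _ "{..n}"]) (auto simp: Des_def)
  have "ldes n \<pi> < p \<longleftrightarrow> (\<forall>i\<in>Des n \<pi>. i < p)"
  proof -
    have "Des n \<pi> \<noteq> {}" using False Des_empty_imp_id[OF assms(1)] by auto
    thus ?thesis using False fin by (simp add: ldes_def)
  qed
  also have "\<dots> \<longleftrightarrow> (\<forall>i. p \<le> i \<and> i < n \<longrightarrow> \<not> \<pi> i > \<pi> (i + 1))"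
  proof -
    have "i \<in> Des n \<pi> \<longleftrightarrow> 1 \<le> i \<and> i < n \<and> \<pi> (i + 1) < \<pi> i" for i
      by (auto simp: Des_def)
    thus ?thesis using assms(2) by (metis le_trans not_less)
  qed
  also have "\<dots> \<longleftrightarrow> (\<forall>i. p \<le> i \<and> i < n \<longrightarrow> \<pi> i < \<pi> (i + 1))"
    using permutes_inj[OF assms(1)]
    by (metis add_cancel_right_right injD zero_neq_one not_less_iff_gr_or_eq)
  finally show ?thesis .
qed

lemma ldes_less:
  assumes "\<pi> permutes {1..n}" "1 \<le> n"
  shows "ldes n \<pi> < n"
  using ldes_less_iff[OF assms] by auto

lemma increasing_after_ldes:
  assumes "\<pi> permutes {1..n}" "ldes n \<pi> < i" "i < j" "j \<le> n"
  shows "\<pi> i < \<pi> j"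
proof -
  have "\<forall>k. i \<le> k \<and> k < n \<longrightarrow> \<pi> k < \<pi> (k + 1)"
    using ldes_less_iff[OF assms(1), of i] assms(2) by auto
  thus ?thesis using assms(3,4)
  proof (induction j)
    case (Suc k)
    have "\<pi> k < \<pi> (k + 1)" using Suc.prems by auto
    moreover have "i = k \<or> \<pi> i < \<pi> k" using Suc by (cases "i < k") auto
    ultimately show ?case by auto
  qed auto
qed

lemma ldes_Suc:
  assumes "\<sigma> permutes {1..m}"
  shows "ldes (Suc m) \<sigma> = ldes m \<sigma>"
proof -
  have perm: "\<sigma> permutes {1..Suc m}" by (rule permutes_subset[OF assms]) auto
  have top: "\<sigma> m < \<sigma> (m + 1)" if "1 \<le> m"
    using permutes_in_image[OF assms, of m] permutes_not_in[OF assms, of "m + 1"] that by auto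
  have iff: "ldes (Suc m) \<sigma> < p \<longleftrightarrow> ldes m \<sigma> < p" if "1 \<le> p" for p
    unfolding ldes_less_iff[OF perm that] ldes_less_iff[OF assms that]
    using top that by (auto simp: less_Suc_eq)
  show ?thesis
    using iff[of "Suc (ldes m \<sigma>)"] iff[of "Suc (ldes (Suc m) \<sigma>)"] by auto
qed

section \<open>Inserting the largest entry\<close>

text \<open>The cycle of positions that puts the entry at position \<open>m + 1\<close> into position \<open>p\<close>
  and shifts the entries at positions \<open>p, \<dots>, m\<close> one step to the right.\<close>

definition position_cycle :: "nat \<Rightarrow> nat \<Rightarrow> nat \<Rightarrow> nat" where
  "position_cycle m p i =
     (if i = p then Suc m else if p < i \<and> i \<le> Suc m then i - 1 else i)"

definition position_cycle_inv :: "nat \<Rightarrow> nat \<Rightarrow> nat \<Rightarrow> nat" where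
  "position_cycle_inv m p i =
     (if i = Suc m then p else if p \<le> i \<and> i \<le> m then Suc i else i)"

text \<open>A permutation \<open>\<sigma>\<close> of \<open>{1..m}\<close> fixes \<open>m + 1\<close>, so as a word of length \<open>m + 1\<close> it
  ends with the largest letter; composing with the cycle moves that letter to position \<open>p\<close>.\<close>

definition insert_max :: "nat \<Rightarrow> (nat \<Rightarrow> nat) \<Rightarrow> nat \<Rightarrow> nat \<Rightarrow> nat" where
  "insert_max m \<sigma> p = \<sigma> \<circ> position_cycle m p"

lemma position_cycle_inverse:
  assumes "p \<le> Suc m"
  shows "position_cycle_inv m p \<circ> position_cycle m p = id"
    and "position_cycle m p \<circ> position_cycle_inv m p = id"
  using assms by (auto simp: position_cycle_def position_cycle_inv_def fun_eq_iff)

lemma inv_position_cycle: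
  assumes "p \<le> Suc m"
  shows "inv (position_cycle m p) = position_cycle_inv m p"
  using position_cycle_inverse[OF assms] by (intro inv_unique_comp) auto

lemma bij_position_cycle:
  assumes "p \<le> Suc m"
  shows "bij (position_cycle m p)"
  using position_cycle_inverse[OF assms] by (rule o_bij)

lemma position_cycle_permutes:
  assumes "1 \<le> p" "p \<le> Suc m"
  shows "position_cycle m p permutes {1..Suc m}"
  using assms bij_position_cycle[OF assms(2)]
  unfolding permutes_def bij_iff by (auto simp: position_cycle_def)

lemma insert_max_permutes:
  assumes "\<sigma> permutes {1..m}" "1 \<le> p" "p \<le> Suc m"
  shows "insert_max m \<sigma> p permutes {1..Suc m}"
  unfolding insert_max_def
  by (rule permutes_compose[OF position_cycle_permutes permutes_subset[OF assms(1)]])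
     (use assms in auto)

lemma inv_insert_max:
  assumes "\<sigma> permutes {1..m}" "p \<le> Suc m"
  shows "inv (insert_max m \<sigma> p) = position_cycle_inv m p \<circ> inv \<sigma>"
  using o_inv_distrib[OF permutes_bij[OF assms(1)] bij_position_cycle[OF assms(2)]]
  by (simp add: insert_max_def inv_position_cycle[OF assms(2)])

lemma lind_insert_max:
  assumes "\<sigma> permutes {1..m}" "p \<le> Suc m"
  shows "lind (Suc m) (insert_max m \<sigma> p) = p"
  using permutes_not_in[OF permutes_inv[OF assms(1)], of "Suc m"]
  by (simp add: lind_def inv_insert_max[OF assms] position_cycle_inv_def)

lemma insert_max_at_end: "insert_max m \<sigma> (Suc m) = \<sigma>"
  by (auto simp: insert_max_def position_cycle_def fun_eq_iff)

lemma insert_max_inj: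
  assumes "\<sigma> permutes {1..m}" "\<tau> permutes {1..m}" "p \<le> Suc m" "r \<le> Suc m"
    and eq: "insert_max m \<sigma> p = insert_max m \<tau> r"
  shows "\<sigma> = \<tau> \<and> p = r"
proof -
  have "p = r"
    using lind_insert_max[OF assms(1,3)] lind_insert_max[OF assms(2,4)] eq by simp
  moreover have "\<sigma> = insert_max m \<sigma> p \<circ> position_cycle_inv m p"
    "\<tau> = insert_max m \<tau> r \<circ> position_cycle_inv m r"
    using position_cycle_inverse(2) assms(3,4) by (simp_all add: insert_max_def comp_assoc)
  ultimately show ?thesis using eq by metis
qed

text \<open>When the new letter is not put at the end it is followed by a smaller letter, and behind it
  the word increases, so its position becomes the last descent.\<close>

lemma ldes_insert_max:
  assumes \<sigma>: "\<sigma> permutes {1..m}" and p: "ldes m \<sigma> < p" "p \<le> Suc m"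
  shows "ldes (Suc m) (insert_max m \<sigma> p) = (if p \<le> m then p else ldes m \<sigma>)"
proof (cases "p \<le> m")
  case False
  hence "p = Suc m" using p by auto
  thus ?thesis by (simp add: insert_max_at_end ldes_Suc[OF \<sigma>])
next
  case True
  let ?\<pi> = "insert_max m \<sigma> p"
  have perm: "?\<pi> permutes {1..Suc m}" using insert_max_permutes[OF \<sigma>] p by auto
  have desc: "?\<pi> (p + 1) < ?\<pi> p"
    using permutes_in_image[OF \<sigma>, of p] permutes_not_in[OF \<sigma>, of "Suc m"] True p
    by (auto simp: insert_max_def position_cycle_def)
  have incr: "?\<pi> i < ?\<pi> (i + 1)" if "Suc p \<le> i" "i < Suc m" for i
    using increasing_after_ldes[OF \<sigma>, of "i - 1" i] that p
    by (auto simp: insert_max_def position_cycle_def)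
  have "ldes (Suc m) ?\<pi> < Suc p"
    using ldes_less_iff[OF perm, of "Suc p"] incr by simp
  moreover have "\<not> ldes (Suc m) ?\<pi> < p"
    using ldes_less_iff[OF perm, of p] desc True p by (auto intro!: exI[of _ p])
  ultimately show ?thesis using True by simp
qed

text \<open>A new 321 pattern would have to use the largest letter, necessarily as its first entry; the
  other two would then form an inversion of \<open>\<sigma>\<close> to the right of the last descent of \<open>\<sigma>\<close>.\<close>

lemma insert_max_in_T_set:
  assumes \<sigma>: "\<sigma> \<in> T_set m" and p: "ldes m \<sigma> < p" "p \<le> Suc m"
  shows "insert_max m \<sigma> p \<in> T_set (Suc m)"
proof -
  let ?\<pi> = "insert_max m \<sigma> p" and ?c = "position_cycle m p"
  have perm: "\<sigma> permutes {1..m}" and av: "avoids_321 m \<sigma>" using \<sigma> by (auto simp: T_set_def)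
  have perm': "?\<pi> permutes {1..Suc m}" using insert_max_permutes[OF perm] p by auto
  have "\<not> (?\<pi> j < ?\<pi> i \<and> ?\<pi> k < ?\<pi> j)"
    if ijk: "i \<in> {1..Suc m}" "j \<in> {1..Suc m}" "k \<in> {1..Suc m}" "i < j" "j < k" for i j k
  proof
    assume dec: "?\<pi> j < ?\<pi> i \<and> ?\<pi> k < ?\<pi> j"
    have max: "?\<pi> p = Suc m"
      using permutes_not_in[OF perm, of "Suc m"] by (simp add: insert_max_def position_cycle_def)
    have le: "?\<pi> x \<le> Suc m" if "x \<in> {1..Suc m}" for x
      using permutes_in_image[OF perm', of x] that by auto
    have "j \<noteq> p" "k \<noteq> p" using dec max le ijk by fastforce+
    show False
    proof (cases "i = p")
      case True
      have "\<sigma> (j - 1) < \<sigma> (k - 1)"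
        using increasing_after_ldes[OF perm, of "j - 1" "k - 1"] p True ijk by auto
      thus False using dec ijk True by (auto simp: insert_max_def position_cycle_def)
    next
      case False
      (* away from position p the cycle keeps the order, so the pattern already occurs in \<sigma> *)
      have "?c i \<in> {1..m}" "?c j \<in> {1..m}" "?c k \<in> {1..m}" "?c i < ?c j" "?c j < ?c k"
        using False \<open>j \<noteq> p\<close> \<open>k \<noteq> p\<close> ijk p by (auto simp: position_cycle_def)
      thus False using av dec unfolding avoids_321_def insert_max_def comp_def by blast
    qed
  qed
  thus ?thesis using perm' unfolding T_set_def avoids_321_def by blast
qed

text \<open>The preimage is obtained by moving the largest letter to the end. A descent of \<open>\<sigma>\<close> at or
  after its old position would, together with that letter, be a 321 pattern of \<open>\<pi>\<close>.\<close>

lemma T_set_Suc_cases: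
  assumes \<pi>: "\<pi> \<in> T_set (Suc m)"
  obtains \<sigma> p where "\<sigma> \<in> T_set m" "ldes m \<sigma> < p" "p \<le> Suc m" "\<pi> = insert_max m \<sigma> p"
proof -
  have perm: "\<pi> permutes {1..Suc m}" and av: "avoids_321 (Suc m) \<pi>"
    using \<pi> by (auto simp: T_set_def)
  define p where "p = inv \<pi> (Suc m)"
  define \<sigma> where "\<sigma> = \<pi> \<circ> position_cycle_inv m p"
  have p: "1 \<le> p" "p \<le> Suc m"
    using permutes_in_image[OF permutes_inv[OF perm], of "Suc m"] by (auto simp: p_def)
  have max: "\<pi> p = Suc m" using permutes_inverses(1)[OF perm] by (simp add: p_def)
  have \<pi>_eq: "\<pi> = insert_max m \<sigma> p"
    using position_cycle_inverse(1)[OF p(2)] by (simp add: insert_max_def \<sigma>_def comp_assoc)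
  have "\<sigma> permutes {1..Suc m}" unfolding \<sigma>_def
    using permutes_compose[OF permutes_inv[OF position_cycle_permutes[OF p]] perm]
    by (simp add: inv_position_cycle[OF p(2)])
  moreover have "\<sigma> x = x" if "x \<in> {1..Suc m} - {1..m}" for x
    using that max by (auto simp: \<sigma>_def position_cycle_inv_def le_Suc_eq)
  ultimately have \<sigma>: "\<sigma> permutes {1..m}" by (rule permutes_superset)
  have "avoids_321 m \<sigma>"
    unfolding avoids_321_def
  proof (rule notI, elim bexE conjE)
    fix i j k assume *: "i \<in> {1..m}" "j \<in> {1..m}" "k \<in> {1..m}" "i < j" "j < k"
      "\<sigma> j < \<sigma> i" "\<sigma> k < \<sigma> j"
    let ?e = "position_cycle_inv m p"
    have "?e i \<in> {1..Suc m}" "?e j \<in> {1..Suc m}" "?e k \<in> {1..Suc m}" "?e i < ?e j" "?e j < ?e k"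
      using * by (auto simp: position_cycle_inv_def)
    thus False using av * unfolding avoids_321_def \<sigma>_def comp_def by blast
  qed
  hence T: "\<sigma> \<in> T_set m" using \<sigma> by (simp add: T_set_def)
  have "\<sigma> i < \<sigma> (i + 1)" if i: "p \<le> i" "i < m" for i
  proof (rule ccontr)
    assume "\<not> \<sigma> i < \<sigma> (i + 1)"
    moreover have "\<sigma> i \<noteq> \<sigma> (i + 1)"
      using permutes_inj[OF \<sigma>] by (metis add_cancel_right_right injD zero_neq_one)
    ultimately have "\<pi> (i + 2) < \<pi> (i + 1)"
      using i by (auto simp: \<sigma>_def position_cycle_inv_def)
    moreover have "\<pi> (i + 1) < \<pi> p"
    proof -
      have "\<pi> (i + 1) \<le> Suc m" using permutes_in_image[OF perm, of "i + 1"] i by auto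
      moreover have "\<pi> (i + 1) \<noteq> \<pi> p" using inj_eq[OF permutes_inj[OF perm]] i by simp
      ultimately show ?thesis using max by auto
    qed
    moreover have "p \<in> {1..Suc m}" "i + 1 \<in> {1..Suc m}" "i + 2 \<in> {1..Suc m}"
      "p < i + 1" "i + 1 < i + 2" using i p by auto
    ultimately show False using av unfolding avoids_321_def by blast
  qed
  hence "ldes m \<sigma> < p" using ldes_less_iff[OF \<sigma> p(1)] by auto
  with T p(2) \<pi>_eq show ?thesis by (intro that)
qed

lemma bij_betw_insert_max:
  "bij_betw (\<lambda>(\<sigma>, p). insert_max m \<sigma> p) (SIGMA \<sigma>:T_set m. {ldes m \<sigma><..Suc m}) (T_set (Suc m))"
proof (rule bij_betw_imageI)
  show "inj_on (\<lambda>(\<sigma>, p). insert_max m \<sigma> p) (SIGMA \<sigma>:T_set m. {ldes m \<sigma><..Suc m})"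
  proof (rule inj_onI, clarsimp simp: T_set_def)
    fix \<sigma> p \<tau> r
    assume "\<sigma> permutes {Suc 0..m}" "\<tau> permutes {Suc 0..m}" "p \<le> Suc m" "r \<le> Suc m"
      and "insert_max m \<sigma> p = insert_max m \<tau> r"
    thus "\<sigma> = \<tau> \<and> p = r" by (intro insert_max_inj) auto
  qed
  show "(\<lambda>(\<sigma>, p). insert_max m \<sigma> p) ` (SIGMA \<sigma>:T_set m. {ldes m \<sigma><..Suc m}) = T_set (Suc m)"
  proof (intro equalityI subsetI)
    fix \<pi> assume "\<pi> \<in> T_set (Suc m)"
    then obtain \<sigma> p where "\<sigma> \<in> T_set m" "ldes m \<sigma> < p" "p \<le> Suc m"
      and "\<pi> = insert_max m \<sigma> p" by (rule T_set_Suc_cases)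
    thus "\<pi> \<in> (\<lambda>(\<sigma>, p). insert_max m \<sigma> p) ` (SIGMA \<sigma>:T_set m. {ldes m \<sigma><..Suc m})"
      by (intro image_eqI[of _ _ "(\<sigma>, p)"]) auto
  qed (auto intro: insert_max_in_T_set)
qed

text \<open>The inverse cycle is increasing on \<open>{1..m}\<close>, so the positions of two letters below the
  largest one compare in the same way before and after the insertion.\<close>

lemma Des_inv_insert_max:
  assumes \<sigma>: "\<sigma> permutes {1..m}" and p: "p \<le> Suc m"
  shows "Des (Suc m) (inv (insert_max m \<sigma> p)) \<inter> {1..m - 1} = Des m (inv \<sigma>)"
proof -
  have mono: "position_cycle_inv m p a < position_cycle_inv m p b \<longleftrightarrow> a < b"
    if "a \<in> {1..m}" "b \<in> {1..m}" for a b
    using that by (auto simp: position_cycle_inv_def)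
  have pos: "inv \<sigma> i \<in> {1..m}" if "i \<in> {1..m}" for i
    using permutes_in_image[OF permutes_inv[OF \<sigma>]] that by blast
  have "inv (insert_max m \<sigma> p) (i + 1) < inv (insert_max m \<sigma> p) i
      \<longleftrightarrow> inv \<sigma> (i + 1) < inv \<sigma> i" if "1 \<le> i" "i \<le> m - 1" for i
    unfolding inv_insert_max[OF assms] comp_def by (rule mono; rule pos) (use that in auto)
  thus ?thesis unfolding Des_def by auto
qed

section \<open>Equidistribution\<close>

text \<open>With \<open>l = ldes m \<sigma>\<close>, the left side is \<open>q\<^sup>l\<^sup>+\<^sup>1 + \<dots> + q\<^sup>m\<close> from the insertions that
  are not at the end, plus \<open>q\<^sup>l\<close> from the insertion at the end; the right side is the same sum
  with the term \<open>q\<^sup>l\<close> coming first.\<close>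

lemma fibre_equidistribution:
  assumes \<sigma>: "\<sigma> \<in> T_set m"
  shows "(\<Sum>p\<in>{ldes m \<sigma><..Suc m}. f (ldes (Suc m) (insert_max m \<sigma> p)))
    = (\<Sum>p\<in>{ldes m \<sigma><..Suc m}. f (lind (Suc m) (insert_max m \<sigma> p) - 1) :: 'a::comm_monoid_add)"
proof -
  define l where "l = ldes m \<sigma>"
  have perm: "\<sigma> permutes {1..m}" using \<sigma> by (simp add: T_set_def)
  have "l \<le> m"
    using ldes_less[OF permutes_subset[OF perm], of "Suc m"] ldes_Suc[OF perm] by (simp add: l_def)
  have "(\<Sum>p\<in>{l<..Suc m}. f (ldes (Suc m) (insert_max m \<sigma> p)))
      = (\<Sum>p\<in>{l<..Suc m}. f (if p \<le> m then p else l))"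
    by (rule sum.cong) (auto simp: ldes_insert_max[OF perm] l_def)
  also have "\<dots> = (\<Sum>p\<in>insert (Suc m) {l<..m}. f (if p \<le> m then p else l))"
    using \<open>l \<le> m\<close> by (intro sum.cong) auto
  also have "\<dots> = f l + (\<Sum>p\<in>{l<..m}. f p)" by simp
  also have "\<dots> = sum f {l..m}"
    using \<open>l \<le> m\<close> by (simp add: sum.head)
  also have "\<dots> = (\<Sum>p\<in>{l<..Suc m}. f (p - 1))"
    by (rule sum.reindex_bij_witness[of _ "\<lambda>p. p - 1" Suc]) auto
  also have "\<dots> = (\<Sum>p\<in>{l<..Suc m}. f (lind (Suc m) (insert_max m \<sigma> p) - 1))"
    by (rule sum.cong) (auto simp: lind_insert_max[OF perm])
  finally show ?thesis by (simp add: l_def)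
qed

lemma finite_T_set: "finite (T_set n)"
  by (rule finite_subset[OF _ finite_permutations[of "{1..n}"]]) (auto simp: T_set_def)

text \<open>Restricting the sum to permutations whose truncated inverse descent set lies in a family
  \<open>\<B>\<close> treats the two claims uniformly: \<^const>\<open>T_set\<close> is the case where \<open>\<B>\<close> consists of
  all sets, and \<^const>\<open>T_set_Des\<close> is the case of a singleton.\<close>

lemma equidistribution:
  fixes f :: "nat \<Rightarrow> 'a::comm_monoid_add" and \<B> :: "nat set set"
  assumes "n \<ge> 1"
  defines "S \<equiv> {\<pi> \<in> T_set n. Des n (inv \<pi>) \<inter> {1..n - 2} \<in> \<B>}"
  shows "(\<Sum>\<pi>\<in>S. f (ldes n \<pi>)) = (\<Sum>\<pi>\<in>S. f (lind n \<pi> - 1))"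
proof -
  obtain m where n: "n = Suc m" using assms(1) by (cases n) auto
  have split: "(\<Sum>\<pi>\<in>S. g \<pi>) = (\<Sum>\<sigma>\<in>T_set m. if Des m (inv \<sigma>) \<in> \<B>
      then \<Sum>p\<in>{ldes m \<sigma><..Suc m}. g (insert_max m \<sigma> p) else 0)" for g :: "_ \<Rightarrow> 'a"
  proof -
    have "(\<Sum>\<pi>\<in>S. g \<pi>)
        = (\<Sum>\<pi>\<in>T_set (Suc m). if Des (Suc m) (inv \<pi>) \<inter> {1..m - 1} \<in> \<B> then g \<pi> else 0)"
      unfolding S_def n by (simp add: sum.inter_filter finite_T_set numeral_2_eq_2)
    also have "\<dots> = (\<Sum>(\<sigma>, p)\<in>(SIGMA \<sigma>:T_set m. {ldes m \<sigma><..Suc m}).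
        if Des m (inv \<sigma>) \<in> \<B> then g (insert_max m \<sigma> p) else 0)"
      by (subst sum.reindex_bij_betw[OF bij_betw_insert_max, symmetric], rule sum.cong)
         (auto simp del: One_nat_def simp: Des_inv_insert_max T_set_def)
    also have "\<dots> = (\<Sum>\<sigma>\<in>T_set m. \<Sum>p\<in>{ldes m \<sigma><..Suc m}.
        if Des m (inv \<sigma>) \<in> \<B> then g (insert_max m \<sigma> p) else 0)"
      by (rule sum.Sigma[symmetric]) (auto simp: finite_T_set)
    finally show ?thesis by (auto intro!: sum.cong)
  qed
  show ?thesis
    unfolding split unfolding n by (intro sum.cong refl if_cong fibre_equidistribution)
qed

theorem theorem1p1:
  fixes n :: nat
  assumes "n \<ge> 1"
  shows "(\<Sum>\<pi>\<in>T_set n. monom 1 (ldes n \<pi>) :: int poly) = (\<Sum>\<pi>\<in>T_set n. monom 1 (lind n \<pi> - 1))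
    \<and> (\<forall>B. B \<subseteq> {1..n - 2} \<longrightarrow>
         (\<Sum>\<pi>\<in>T_set_Des n B. monom 1 (ldes n \<pi>) :: int poly)
           = (\<Sum>\<pi>\<in>T_set_Des n B. monom 1 (lind n \<pi> - 1)))"
  using equidistribution[OF assms, where \<B> = UNIV and f = "monom (1::int)"]
    equidistribution[OF assms, where \<B> = "{B}" and f = "monom (1::int)" for B]
  by (simp add: T_set_Des_def)

end
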